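(* Let $\mathcal{C}$ be the class of sofic groups. Suppose that $\Gamma,\Delta\in\mathcal{C}$ and that $\beta:\Gamma\to\operatorname{Aut}(\Delta)$ is a sofic $\mathcal{C}$-action by automorphisms. Then the semidirect product $\Delta\rtimes_{\beta}\Gamma$ is a sofic group.
   Context: For a finite set $A$, the normalized Hamming metric on $\operatorname{Sym}(A)$ is $d_A(\sigma,\tau)=1-\frac{1}{|A|}|\{a\in A:\sigma(a)=\tau(a)\}|$. For a group $\Gamma$, a group $G$ with bounded bi-invariant metric $d$, a function $\varphi:\Gamma\to G$, a finite set $F\subseteq\Gamma$ and $\epsilon,c>0$: $\varphi$ is $(F,\epsilon)$-multiplicative if $d(\varphi(gh),\varphi(g)\varphi(h))<\epsilon$ for all $g,h\in F$ with $gh\in F$; $\varphi$ is $(F,c)$-separating if $d(\varphi(g),e_G)>c$ for all $e\neq g\in F$; $\varphi$ is unital if $\varphi(e_\Gamma)=e_G$. A group $\Gamma$ is sofic if there is $c>0$ such that for all finite $F\subseteq\Gamma$ and $\epsilon>0$ there are $n\in\mathbb{N}$ and a unital, $(F,\epsilon)$-multiplicative, $(F,c)$-separating function $\Gamma\to\operatorname{Sym}(n)$ (with the normalized Hamming metric). A partial homomorphism from a subset $E$ of a group to a group $\Lambda$ is a function $\pi:E\to\Lambda$ with $\pi(gh)=\pi(g)\pi(h)$ whenever $g,h,gh\in E$. Sofic $\mathcal{C}$-action by automorphisms: let $\alpha:\Gamma\to\operatorname{Aut}(\Delta)$ be a homomorphism, $A$ a finite set, $\varphi:\Gamma\to\operatorname{Sym}(A)$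 a function, $F\subseteq\Gamma$, $E\subseteq\Delta$ finite, $\epsilon>0$, and $\Lambda$ a group. Then $\varphi$ is an $(F,E,\epsilon,\Lambda)$-automorphic approximation of $\alpha$ if there exist $S\subseteq A$ with $|S|>(1-\epsilon)|A|$ and injective partial homomorphisms $(\pi_s:E\to\Lambda)_{s\in S}$ such that for all $g\in F$, $h\in E$, $s\in S$, if $\varphi(g)\cdot s\in S$ and $\alpha(g)^{-1}[h]\in E$, then $\pi_{\varphi(g)\cdot s}(h)=\pi_s(\alpha(g)^{-1}[h])$. For a class $\mathcal{C}$ of groups, $\alpha$ is a sofic $\mathcal{C}$-action if for all finite $F\subseteq\Gamma$, $E\subseteq\Delta$ and $\epsilon>0$ there exist $\Lambda\in\mathcal{C}$, a finite set $A$ and a unital $(F,\epsilon)$-multiplicative function $\varphi:\Gamma\to\operatorname{Sym}(A)$ which is an $(F,E,\epsilon,\Lambda)$-automorphic approximation of $\alpha$ (multiplicativity being with respect to $d_A$). *)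

theory Defs
  imports Complex_Main "HOL-Algebra.Bij"
begin

text \<open>Sym(A) is the library group \<open>BijGroup A\<close>, and Sym(n) is \<open>BijGroup {1..n}\<close>.\<close>

definition hamming :: "'a set \<Rightarrow> ('a \<Rightarrow> 'a) \<Rightarrow> ('a \<Rightarrow> 'a) \<Rightarrow> real" where
  "hamming A \<sigma> \<tau> = 1 - real (card {a \<in> A. \<sigma> a = \<tau> a}) / real (card A)"

definition multiplicative_approx ::
  "('g, 'm) monoid_scheme \<Rightarrow> ('b, 'n) monoid_scheme \<Rightarrow> ('b \<Rightarrow> 'b \<Rightarrow> real) \<Rightarrow>
    'g set \<Rightarrow> real \<Rightarrow> ('g \<Rightarrow> 'b) \<Rightarrow> bool" where
  "multiplicative_approx \<Gamma> G d F \<epsilon> \<phi> \<longleftrightarrow>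
    (\<forall>g\<in>F. \<forall>h\<in>F. g \<otimes>\<^bsub>\<Gamma>\<^esub> h \<in> F \<longrightarrow> d (\<phi> (g \<otimes>\<^bsub>\<Gamma>\<^esub> h)) (\<phi> g \<otimes>\<^bsub>G\<^esub> \<phi> h) < \<epsilon>)"

definition separating ::
  "('g, 'm) monoid_scheme \<Rightarrow> ('b, 'n) monoid_scheme \<Rightarrow> ('b \<Rightarrow> 'b \<Rightarrow> real) \<Rightarrow>
    'g set \<Rightarrow> real \<Rightarrow> ('g \<Rightarrow> 'b) \<Rightarrow> bool" where
  "separating \<Gamma> G d F c \<phi> \<longleftrightarrow> (\<forall>g\<in>F. g \<noteq> \<one>\<^bsub>\<Gamma>\<^esub> \<longrightarrow> d (\<phi> g) \<one>\<^bsub>G\<^esub> > c)"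

definition unital ::
  "('g, 'm) monoid_scheme \<Rightarrow> ('b, 'n) monoid_scheme \<Rightarrow> ('g \<Rightarrow> 'b) \<Rightarrow> bool" where
  "unital \<Gamma> G \<phi> \<longleftrightarrow> \<phi> \<one>\<^bsub>\<Gamma>\<^esub> = \<one>\<^bsub>G\<^esub>"

text \<open>The condition \<open>n > 0\<close> below excludes the empty set, on which the normalized Hamming
  metric is not meaningful (division by zero).\<close>

definition sofic :: "('g, 'm) monoid_scheme \<Rightarrow> bool" where
  "sofic \<Gamma> \<longleftrightarrow> group \<Gamma> \<and>
    (\<exists>c>0. \<forall>F \<epsilon>. finite F \<and> F \<subseteq> carrier \<Gamma> \<and> \<epsilon> > 0 \<longrightarrow>
      (\<exists>(n::nat) \<phi>. n > 0 \<and>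
        \<phi> \<in> carrier \<Gamma> \<rightarrow> carrier (BijGroup {1..n}) \<and>
        unital \<Gamma> (BijGroup {1..n}) \<phi> \<and>
        multiplicative_approx \<Gamma> (BijGroup {1..n}) (hamming {1..n}) F \<epsilon> \<phi> \<and>
        separating \<Gamma> (BijGroup {1..n}) (hamming {1..n}) F c \<phi>))"

definition partial_hom ::
  "('d, 'm) monoid_scheme \<Rightarrow> 'd set \<Rightarrow> ('l, 'n) monoid_scheme \<Rightarrow> ('d \<Rightarrow> 'l) \<Rightarrow> bool" where
  "partial_hom \<Delta> E \<Lambda> \<pi> \<longleftrightarrow> \<pi> \<in> E \<rightarrow> carrier \<Lambda> \<and>
    (\<forall>g\<in>E. \<forall>h\<in>E. g \<otimes>\<^bsub>\<Delta>\<^esub> h \<in> E \<longrightarrow> \<pi> (g \<otimes>\<^bsub>\<Delta>\<^esub> h) = \<pi> g \<otimes>\<^bsub>\<Lambda>\<^esub> \<pi> h)"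

definition automorphic_approx ::
  "('d, 'm) monoid_scheme \<Rightarrow> ('g \<Rightarrow> 'd \<Rightarrow> 'd) \<Rightarrow> 'a set \<Rightarrow> 'g set \<Rightarrow> 'd set \<Rightarrow> real \<Rightarrow>
    ('l, 'n) monoid_scheme \<Rightarrow> ('g \<Rightarrow> 'a \<Rightarrow> 'a) \<Rightarrow> bool" where
  "automorphic_approx \<Delta> \<alpha> A F E \<epsilon> \<Lambda> \<phi> \<longleftrightarrow>
    (\<exists>S \<pi>. S \<subseteq> A \<and> real (card S) > (1 - \<epsilon>) * real (card A) \<and>
      (\<forall>s\<in>S. partial_hom \<Delta> E \<Lambda> (\<pi> s) \<and> inj_on (\<pi> s) E) \<and>
      (\<forall>g\<in>F. \<forall>h\<in>E. \<forall>s\<in>S.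
        \<phi> g s \<in> S \<and> (inv\<^bsub>AutoGroup \<Delta>\<^esub> (\<alpha> g)) h \<in> E \<longrightarrow>
        \<pi> (\<phi> g s) h = \<pi> s ((inv\<^bsub>AutoGroup \<Delta>\<^esub> (\<alpha> g)) h)))"

text \<open>A class of groups is represented by a set \<open>C\<close> of groups over a type \<open>'l\<close>. No generality is
  lost by letting all the groups \<open>\<Lambda>\<close> live on one type when \<open>'l\<close> is arbitrary: only one
  \<open>\<Lambda>\<close> is chosen for each triple \<open>F\<close>, \<open>E\<close>, \<open>\<epsilon>\<close>, and these
  can be taken on a sufficiently large common type. Likewise, up to relabelling, a finite set
  \<open>A\<close> is a finite set of natural numbers.\<close>

definition sofic_action ::
  "'l monoid set \<Rightarrow> ('g, 'm) monoid_scheme \<Rightarrow> ('d, 'n) monoid_scheme \<Rightarrow>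
    ('g \<Rightarrow> 'd \<Rightarrow> 'd) \<Rightarrow> bool" where
  "sofic_action C \<Gamma> \<Delta> \<alpha> \<longleftrightarrow> \<alpha> \<in> hom \<Gamma> (AutoGroup \<Delta>) \<and>
    (\<forall>F E \<epsilon>. finite F \<and> F \<subseteq> carrier \<Gamma> \<and> finite E \<and> E \<subseteq> carrier \<Delta> \<and> \<epsilon> > 0 \<longrightarrow>
      (\<exists>\<Lambda>\<in>C. \<exists>(A::nat set) \<phi>. finite A \<and>
        \<phi> \<in> carrier \<Gamma> \<rightarrow> carrier (BijGroup A) \<and>
        unital \<Gamma> (BijGroup A) \<phi> \<and>
        multiplicative_approx \<Gamma> (BijGroup A) (hamming A) F \<epsilon> \<phi> \<and>
        automorphic_approx \<Delta> \<alpha> A F E \<epsilon> \<Lambda> \<phi>))"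

definition semidirect_product ::
  "('d, 'n) monoid_scheme \<Rightarrow> ('g \<Rightarrow> 'd \<Rightarrow> 'd) \<Rightarrow> ('g, 'm) monoid_scheme \<Rightarrow> ('d \<times> 'g) monoid" where
  "semidirect_product \<Delta> \<beta> \<Gamma> =
    \<lparr>carrier = carrier \<Delta> \<times> carrier \<Gamma>,
     mult = (\<lambda>(x, g) (y, h). (x \<otimes>\<^bsub>\<Delta>\<^esub> \<beta> g y, g \<otimes>\<^bsub>\<Gamma>\<^esub> h)),
     one = (\<one>\<^bsub>\<Delta>\<^esub>, \<one>\<^bsub>\<Gamma>\<^esub>)\<rparr>"

end

theory Submission
  imports Defs
begin

text \<open>
  Let \<open>\<phi>\<close> on \<open>A\<close> be an automorphic approximation of \<open>\<beta>\<close> with partial homomorphisms \<open>\<pi>\<^sub>s\<close> into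
  \<open>\<Lambda>\<close>, and let \<open>\<theta>\<close> on \<open>B\<close> be a sofic approximation of \<open>\<Lambda>\<close>. Then \<open>(x, g)\<close> acts on \<open>A \<times> B\<close> by
  \<open>(s, b) \<mapsto> (t, \<theta> (\<pi>\<^sub>t x) b)\<close> with \<open>t = \<phi> g s\<close>; the equivariance of \<open>\<pi>\<close> makes this
  almost multiplicative, and the injectivity of \<open>\<pi>\<^sub>s\<close> separates \<open>(x, 1)\<close> from the identity.
  Taking the product with a sofic approximation of \<open>\<Gamma>\<close> separates the remaining elements.
  Since \<open>\<Lambda>\<close>, and with it the separation constant of \<open>\<Lambda>\<close>, varies with the
  approximation, that constant must first be made uniform: the diagonal action on \<open>B \<times> B\<close> squares
  the proportion of fixed points.
\<close>

section \<open>Densities\<close>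

text \<open>By the convention on division by zero the value is 0 for empty or infinite
  \<open>A\<close>, so some of the rules below hold for arbitrary sets.\<close>

definition density :: "'a set \<Rightarrow> ('a \<Rightarrow> bool) \<Rightarrow> real" where
  "density A P = real (card {a \<in> A. P a}) / real (card A)"

lemma density_nonneg: "0 \<le> density A P"
  by (simp add: density_def)

lemma density_cong: "(\<And>a. a \<in> A \<Longrightarrow> P a = Q a) \<Longrightarrow> density A P = density A Q"
  unfolding density_def by (metis (mono_tags, lifting) Collect_cong)

lemma density_le_1:
  assumes "finite A" shows "density A P \<le> 1"
proof -
  have "card {a \<in> A. P a} \<le> card A"
    by (intro card_mono) (use assms in auto)
  then show ?thesis
    unfolding density_def by (simp add: divide_le_eq)
qed

lemma density_disj: "density A (\<lambda>a. P a \<or> Q a) \<le> density A P + density A Q"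
proof -
  have "{a \<in> A. P a \<or> Q a} = {a \<in> A. P a} \<union> {a \<in> A. Q a}" by auto
  then have "card {a \<in> A. P a \<or> Q a} \<le> card {a \<in> A. P a} + card {a \<in> A. Q a}"
    by (metis card_Un_le)
  then have "real (card {a \<in> A. P a \<or> Q a}) \<le> real (card {a \<in> A. P a}) + real (card {a \<in> A. Q a})"
    by linarith
  then show ?thesis
    unfolding density_def add_divide_distrib[symmetric] by (intro divide_right_mono) auto
qed

lemma density_compl:
  assumes "finite A" "A \<noteq> {}"
  shows "density A (\<lambda>a. \<not> P a) = 1 - density A P"
proof -
  have "{a \<in> A. \<not> P a} = A - {a \<in> A. P a}" by auto
  then have "card {a \<in> A. \<not> P a} = card A - card {a \<in> A. P a}"
    using assms by (simp add: card_Diff_subset)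
  moreover have "card {a \<in> A. P a} \<le> card A"
    by (intro card_mono) (use assms in auto)
  moreover have "card A > 0" using assms by (simp add: card_gt_0_iff)
  ultimately show ?thesis
    by (simp add: density_def of_nat_diff diff_divide_distrib)
qed

lemma density_times:
  "density (A \<times> B) (\<lambda>(a, b). P a \<and> Q b) = density A P * density B Q"
proof -
  have "{p \<in> A \<times> B. case p of (a, b) \<Rightarrow> P a \<and> Q b} = {a \<in> A. P a} \<times> {b \<in> B. Q b}" by auto
  then show ?thesis by (simp add: density_def card_cartesian_product)
qed

lemma density_bij:
  assumes "bij_betw f A B"
  shows "density A (\<lambda>a. P (f a)) = density B P"
proof -
  have "bij_betw f {a \<in> A. P (f a)} {b \<in> B. P b}"
    using assms by (auto simp: bij_betw_def inj_on_def)
  then show ?thesis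
    using assms by (simp add: density_def bij_betw_same_card)
qed

text \<open>Count the pairs fibre by fibre over \<open>A\<close>: a fibre over a bad point, where
  \<open>P\<close> holds, contributes at most \<open>card B\<close>, any other at most
  \<open>q * card B\<close>. Every estimate on a product set below, for errors as well as for fixed
  points, is an instance.\<close>

lemma density_fibrewise:
  assumes fin: "finite A" "finite B" and q: "0 \<le> q"
    and fibre: "\<And>a. a \<in> A \<Longrightarrow> \<not> P a \<Longrightarrow> density B (\<lambda>b. R a b) \<le> q"
  shows "density (A \<times> B) (\<lambda>(a, b). R a b) \<le> density A P + q"
proof (cases "A = {} \<or> B = {}")
  case True
  then show ?thesis using q by (auto simp: density_def)
next
  case False
  then have pos: "card A > 0" "card B > 0" using fin by (auto simp: card_gt_0_iff)
  have "{p \<in> A \<times> B. case p of (a, b) \<Rightarrow> R a b} = Sigma A (\<lambda>a. {b \<in> B. R a b})" by auto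
  then have "real (card {p \<in> A \<times> B. case p of (a, b) \<Rightarrow> R a b}) =
      (\<Sum>a\<in>A. real (card {b \<in> B. R a b}))"
    using fin by (simp add: card_SigmaI)
  also have "\<dots> \<le> (\<Sum>a\<in>A. (if P a then real (card B) else 0) + q * real (card B))"
  proof (intro sum_mono)
    fix a assume a: "a \<in> A"
    have "card {b \<in> B. R a b} \<le> card B"
      by (intro card_mono) (use fin in auto)
    then show "real (card {b \<in> B. R a b}) \<le> (if P a then real (card B) else 0) + q * real (card B)"
      using fibre[OF a] q pos by (cases "P a") (simp_all add: density_def divide_le_eq add_increasing2)
  qed
  also have "\<dots> = real (card {a \<in> A. P a}) * real (card B) + q * real (card A) * real (card B)"
    using fin by (simp add: sum.distrib sum.If_cases Int_def)
  finally show ?thesis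
    using pos by (simp add: density_def card_cartesian_product field_simps)
qed

text \<open>Nonemptiness matters: on the empty set the left side would be 1 and the right side
  0.\<close>

lemma hamming_eq_density:
  assumes "finite A" "A \<noteq> {}"
  shows "hamming A \<sigma> \<tau> = density A (\<lambda>a. \<sigma> a \<noteq> \<tau> a)"
  unfolding density_compl[OF assms] by (simp add: hamming_def density_def)

section \<open>Almost multiplicative families of permutations\<close>

text \<open>The permutations need not be extensional here, so that pulling back, transporting along
  bijections and forming products require no restriction operators.\<close>

definition almost_action ::
  "('g, 'm) monoid_scheme \<Rightarrow> 'g set \<Rightarrow> real \<Rightarrow> 'a set \<Rightarrow> ('g \<Rightarrow> 'a \<Rightarrow> 'a) \<Rightarrow> bool" where
  "almost_action \<Gamma> F \<epsilon> A \<phi> \<longleftrightarrow> finite A \<and> A \<noteq> {} \<and>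
    (\<forall>g\<in>carrier \<Gamma>. bij_betw (\<phi> g) A A) \<and> (\<forall>a\<in>A. \<phi> \<one>\<^bsub>\<Gamma>\<^esub> a = a) \<and>
    (\<forall>g\<in>F. \<forall>h\<in>F. g \<otimes>\<^bsub>\<Gamma>\<^esub> h \<in> F \<longrightarrow>
      density A (\<lambda>a. \<phi> (g \<otimes>\<^bsub>\<Gamma>\<^esub> h) a \<noteq> \<phi> g (\<phi> h a)) < \<epsilon>)"

text \<open>This is 1 minus the Hamming distance to the identity. Separation becomes an upper bound
  on it, which is convenient because it is multiplicative under products of permutations.\<close>

definition fixed_density :: "'a set \<Rightarrow> ('a \<Rightarrow> 'a) \<Rightarrow> real" where
  "fixed_density A \<sigma> = density A (\<lambda>a. \<sigma> a = a)"

lemma fixed_density_nonneg: "0 \<le> fixed_density A \<sigma>"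
  by (simp add: fixed_density_def density_nonneg)

lemma fixed_density_le_1: "finite A \<Longrightarrow> fixed_density A \<sigma> \<le> 1"
  by (simp add: fixed_density_def density_le_1)

lemma almost_actionD:
  assumes "almost_action \<Gamma> F \<epsilon> A \<phi>"
  shows "finite A" "A \<noteq> {}" "\<And>g. g \<in> carrier \<Gamma> \<Longrightarrow> bij_betw (\<phi> g) A A"
    "\<And>a. a \<in> A \<Longrightarrow> \<phi> \<one>\<^bsub>\<Gamma>\<^esub> a = a"
    "\<And>g h. g \<in> F \<Longrightarrow> h \<in> F \<Longrightarrow> g \<otimes>\<^bsub>\<Gamma>\<^esub> h \<in> F \<Longrightarrow>
      density A (\<lambda>a. \<phi> (g \<otimes>\<^bsub>\<Gamma>\<^esub> h) a \<noteq> \<phi> g (\<phi> h a)) < \<epsilon>"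
  using assms by (auto simp: almost_action_def)

section \<open>Comparison with functions into the symmetric group\<close>

lemma almost_action_of_BijGroup:
  assumes fin: "finite A" "A \<noteq> {}" and F: "F \<subseteq> carrier \<Gamma>"
    and \<phi>: "\<phi> \<in> carrier \<Gamma> \<rightarrow> carrier (BijGroup A)"
    and un: "unital \<Gamma> (BijGroup A) \<phi>"
    and mul: "multiplicative_approx \<Gamma> (BijGroup A) (hamming A) F \<epsilon> \<phi>"
  shows "almost_action \<Gamma> F \<epsilon> A \<phi>"
  unfolding almost_action_def
proof (intro conjI ballI impI)
  have Bij: "\<phi> g \<in> Bij A" if "g \<in> carrier \<Gamma>" for g
    using \<phi> that by (auto simp: BijGroup_def)
  then show "bij_betw (\<phi> g) A A" if "g \<in> carrier \<Gamma>" for g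
    using that by (auto simp: Bij_def)
  show "\<phi> \<one>\<^bsub>\<Gamma>\<^esub> a = a" if "a \<in> A" for a
    using un that by (simp add: unital_def BijGroup_def)
  fix g h assume gh: "g \<in> F" "h \<in> F" "g \<otimes>\<^bsub>\<Gamma>\<^esub> h \<in> F"
  then have "\<phi> g \<otimes>\<^bsub>BijGroup A\<^esub> \<phi> h = compose A (\<phi> g) (\<phi> h)"
    using Bij F by (auto simp: BijGroup_def)
  then have "hamming A (\<phi> (g \<otimes>\<^bsub>\<Gamma>\<^esub> h)) (compose A (\<phi> g) (\<phi> h)) < \<epsilon>"
    using mul gh by (metis multiplicative_approx_def)
  then show "density A (\<lambda>a. \<phi> (g \<otimes>\<^bsub>\<Gamma>\<^esub> h) a \<noteq> \<phi> g (\<phi> h a)) < \<epsilon>"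
    unfolding hamming_eq_density[OF fin] by (simp add: compose_def cong: density_cong)
qed (use fin in auto)

text \<open>Elements of \<open>Bij A\<close> are extensional, hence the restriction. It changes no
  value on \<open>A\<close>, and \<open>\<phi> h\<close> maps \<open>A\<close> into itself, so the
  densities stay the same.\<close>

lemma almost_action_imp_BijGroup:
  assumes act: "almost_action \<Gamma> F \<epsilon> A \<phi>" and F: "F \<subseteq> carrier \<Gamma>"
  defines "\<psi> \<equiv> \<lambda>g. restrict (\<phi> g) A"
  shows "\<psi> \<in> carrier \<Gamma> \<rightarrow> carrier (BijGroup A)" (is ?A)
    and "unital \<Gamma> (BijGroup A) \<psi>" (is ?B)
    and "multiplicative_approx \<Gamma> (BijGroup A) (hamming A) F \<epsilon> \<psi>" (is ?C)
proof -
  note actD = almost_actionD[OF act]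
  have Bij: "\<psi> g \<in> Bij A" if "g \<in> carrier \<Gamma>" for g
    using actD(3)[OF that] by (auto simp: Bij_def \<psi>_def cong: bij_betw_cong)
  then show ?A by (auto simp: BijGroup_def)
  show ?B using actD(4) by (auto simp: unital_def \<psi>_def BijGroup_def)
  show ?C
    unfolding multiplicative_approx_def
  proof (intro ballI impI)
    fix g h assume gh: "g \<in> F" "h \<in> F" "g \<otimes>\<^bsub>\<Gamma>\<^esub> h \<in> F"
    then have h: "h \<in> carrier \<Gamma>" using F by auto
    have eq: "\<psi> g \<otimes>\<^bsub>BijGroup A\<^esub> \<psi> h = compose A (\<psi> g) (\<psi> h)"
      using Bij F gh by (auto simp: BijGroup_def)
    have in_A: "\<phi> h a \<in> A" if "a \<in> A" for a
      using actD(3)[OF h] that by (auto simp: bij_betw_def)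
    have "density A (\<lambda>a. \<psi> (g \<otimes>\<^bsub>\<Gamma>\<^esub> h) a \<noteq> compose A (\<psi> g) (\<psi> h) a) =
      density A (\<lambda>a. \<phi> (g \<otimes>\<^bsub>\<Gamma>\<^esub> h) a \<noteq> \<phi> g (\<phi> h a))"
      by (intro density_cong) (simp add: compose_def \<psi>_def in_A)
    then show "hamming A (\<psi> (g \<otimes>\<^bsub>\<Gamma>\<^esub> h)) (\<psi> g \<otimes>\<^bsub>BijGroup A\<^esub> \<psi> h) < \<epsilon>"
      using actD(5)[OF gh] hamming_eq_density[OF actD(1,2)] eq by metis
  qed
qed

text \<open>Conjugating by a bijection changes no density. This allows approximations to be built on
  any convenient finite set and relabelled by \<open>{1..n}\<close> afterwards.\<close>

lemma almost_action_transfer: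
  assumes act: "almost_action \<Gamma> F \<epsilon> A \<phi>" and F: "F \<subseteq> carrier \<Gamma>" and f: "bij_betw f A B"
  defines "\<psi> \<equiv> \<lambda>g b. f (\<phi> g (inv_into A f b))"
  shows "almost_action \<Gamma> F \<epsilon> B \<psi>"
    and "g \<in> carrier \<Gamma> \<Longrightarrow> fixed_density B (\<psi> g) = fixed_density A (\<phi> g)"
proof -
  note actD = almost_actionD[OF act]
  have inj: "inj_on f A" and B: "B = f ` A" using f by (auto simp: bij_betw_def)
  have in_A: "\<phi> g a \<in> A" if "g \<in> carrier \<Gamma>" "a \<in> A" for g a
    using actD(3) that by (auto simp: bij_betw_def)
  have \<psi>: "\<psi> g (f a) = f (\<phi> g a)" if "a \<in> A" for g a
    using that inj by (simp add: \<psi>_def)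
  show "almost_action \<Gamma> F \<epsilon> B \<psi>"
    unfolding almost_action_def
  proof (intro conjI ballI impI)
    show "finite B" "B \<noteq> {}" using actD(1,2) B by auto
    show "bij_betw (\<psi> g) B B" if "g \<in> carrier \<Gamma>" for g
    proof -
      have "bij_betw (f \<circ> (\<phi> g \<circ> inv_into A f)) B B"
        using bij_betw_inv_into[OF f] actD(3)[OF that] f by (blast intro: bij_betw_trans)
      then show ?thesis by (simp add: \<psi>_def comp_def)
    qed
    show "\<psi> \<one>\<^bsub>\<Gamma>\<^esub> b = b" if "b \<in> B" for b
      using that \<psi> actD(4) by (auto simp: B)
    fix g h assume gh: "g \<in> F" "h \<in> F" "g \<otimes>\<^bsub>\<Gamma>\<^esub> h \<in> F"
    have "density B (\<lambda>b. \<psi> (g \<otimes>\<^bsub>\<Gamma>\<^esub> h) b \<noteq> \<psi> g (\<psi> h b)) =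
        density A (\<lambda>a. \<psi> (g \<otimes>\<^bsub>\<Gamma>\<^esub> h) (f a) \<noteq> \<psi> g (\<psi> h (f a)))"
      by (rule density_bij[OF f, symmetric])
    also have "\<dots> = density A (\<lambda>a. \<phi> (g \<otimes>\<^bsub>\<Gamma>\<^esub> h) a \<noteq> \<phi> g (\<phi> h a))"
      using gh F by (intro density_cong) (simp add: \<psi> in_A subset_iff inj_on_eq_iff[OF inj])
    finally show "density B (\<lambda>b. \<psi> (g \<otimes>\<^bsub>\<Gamma>\<^esub> h) b \<noteq> \<psi> g (\<psi> h b)) < \<epsilon>"
      using actD(5)[OF gh] by simp
  qed
  show "fixed_density B (\<psi> g) = fixed_density A (\<phi> g)" if "g \<in> carrier \<Gamma>"
  proof -
    have "fixed_density B (\<psi> g) = density A (\<lambda>a. \<psi> g (f a) = f a)"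
      unfolding fixed_density_def by (rule density_bij[OF f, symmetric])
    also have "\<dots> = fixed_density A (\<phi> g)"
      unfolding fixed_density_def
      using that by (intro density_cong) (simp add: \<psi> in_A inj_on_eq_iff[OF inj])
    finally show ?thesis .
  qed
qed

text \<open>Multiplicativity fails at a pair only if it fails in one of the two coordinates, so the
  errors add.\<close>

lemma almost_action_times:
  assumes actA: "almost_action \<Gamma> F \<delta> A \<phi>" and actB: "almost_action \<Gamma> F \<epsilon> B \<psi>"
  shows "almost_action \<Gamma> F (\<delta> + \<epsilon>) (A \<times> B) (\<lambda>g. map_prod (\<phi> g) (\<psi> g))"
  unfolding almost_action_def
proof (intro conjI ballI impI)
  note A = almost_actionD[OF actA] and B = almost_actionD[OF actB]
  show "finite (A \<times> B)" "A \<times> B \<noteq> {}" using A B by auto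
  show "bij_betw (map_prod (\<phi> g) (\<psi> g)) (A \<times> B) (A \<times> B)" if "g \<in> carrier \<Gamma>" for g
    using A(3)[OF that] B(3)[OF that] by (rule bij_betw_map_prod)
  show "map_prod (\<phi> \<one>\<^bsub>\<Gamma>\<^esub>) (\<psi> \<one>\<^bsub>\<Gamma>\<^esub>) p = p" if "p \<in> A \<times> B" for p
    using that A(4) B(4) by auto
  fix g h assume gh: "g \<in> F" "h \<in> F" "g \<otimes>\<^bsub>\<Gamma>\<^esub> h \<in> F"
  let ?P = "\<lambda>a. \<phi> (g \<otimes>\<^bsub>\<Gamma>\<^esub> h) a \<noteq> \<phi> g (\<phi> h a)"
  let ?Q = "\<lambda>b. \<psi> (g \<otimes>\<^bsub>\<Gamma>\<^esub> h) b \<noteq> \<psi> g (\<psi> h b)"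
  have "density (A \<times> B) (\<lambda>(a, b). ?P a \<or> ?Q b) \<le> density A ?P + density B ?Q"
    by (intro density_fibrewise A B density_nonneg) auto
  also have "\<dots> < \<delta> + \<epsilon>"
    using A(5)[OF gh] B(5)[OF gh] by linarith
  finally show "density (A \<times> B) (\<lambda>p. map_prod (\<phi> (g \<otimes>\<^bsub>\<Gamma>\<^esub> h)) (\<psi> (g \<otimes>\<^bsub>\<Gamma>\<^esub> h)) p \<noteq>
      map_prod (\<phi> g) (\<psi> g) (map_prod (\<phi> h) (\<psi> h) p)) < \<delta> + \<epsilon>"
    by (simp add: case_prod_unfold map_prod_def)
qed

text \<open>A pair is fixed exactly when both coordinates are. This drives both the amplification
  and the final separation estimate.\<close>

lemma fixed_density_times:
  "fixed_density (A \<times> B) (map_prod \<sigma> \<tau>) = fixed_density A \<sigma> * fixed_density B \<tau>"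
  unfolding fixed_density_def density_times[symmetric]
  by (rule density_cong) auto

lemma almost_action_mono:
  "almost_action \<Gamma> F \<delta> A \<phi> \<Longrightarrow> \<delta> \<le> \<epsilon> \<Longrightarrow> almost_action \<Gamma> F \<epsilon> A \<phi>"
  unfolding almost_action_def by (meson less_le_trans)

text \<open>Used to let a semidirect product act through its projection to \<Gamma>. Preservation of
  the unit is a separate assumption because neither structure is required to be a group
  here.\<close>

lemma almost_action_pullback:
  assumes act: "almost_action \<Gamma> (f ` F) \<epsilon> A \<phi>" and f: "f \<in> hom G \<Gamma>"
    and F: "F \<subseteq> carrier G" and one: "f \<one>\<^bsub>G\<^esub> = \<one>\<^bsub>\<Gamma>\<^esub>"
  shows "almost_action G F \<epsilon> A (\<lambda>x. \<phi> (f x))"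
  unfolding almost_action_def
proof (intro conjI ballI impI)
  note actD = almost_actionD[OF act]
  show "finite A" "A \<noteq> {}" by (fact actD)+
  show "bij_betw (\<phi> (f x)) A A" if "x \<in> carrier G" for x
    using that f actD(3) by (auto simp: hom_def)
  show "\<phi> (f \<one>\<^bsub>G\<^esub>) a = a" if "a \<in> A" for a
    using that actD(4) one by simp
  fix x y assume xy: "x \<in> F" "y \<in> F" "x \<otimes>\<^bsub>G\<^esub> y \<in> F"
  then have eq: "f (x \<otimes>\<^bsub>G\<^esub> y) = f x \<otimes>\<^bsub>\<Gamma>\<^esub> f y"
    using f F by (auto simp: hom_def)
  then have "f x \<otimes>\<^bsub>\<Gamma>\<^esub> f y \<in> f ` F"
    using xy by (metis imageI)
  then show "density A (\<lambda>a. \<phi> (f (x \<otimes>\<^bsub>G\<^esub> y)) a \<noteq> \<phi> (f x) (\<phi> (f y) a)) < \<epsilon>"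
    unfolding eq using actD(5) xy by simp
qed

section \<open>Amplification\<close>

text \<open>Soficity with the separation constant made explicit: \<open>q\<close> plays the role of
  \<open>1 - c\<close> and is fixed before \<open>F\<close> and \<open>\<epsilon>\<close>.\<close>

definition sofic_with :: "('g, 'm) monoid_scheme \<Rightarrow> real \<Rightarrow> bool" where
  "sofic_with \<Gamma> q \<longleftrightarrow>
    (\<forall>F \<epsilon>. finite F \<and> F \<subseteq> carrier \<Gamma> \<and> \<epsilon> > 0 \<longrightarrow>
      (\<exists>(n::nat) \<phi>. almost_action \<Gamma> F \<epsilon> {1..n} \<phi> \<and>
        (\<forall>g\<in>F. g \<noteq> \<one>\<^bsub>\<Gamma>\<^esub> \<longrightarrow> fixed_density {1..n} (\<phi> g) < q)))"

text \<open>The finite set may live on any type, in particular on a product type, since a bijection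
  with \<open>{1..card A}\<close> transports the almost action.\<close>

lemma sofic_withI:
  assumes "\<And>F \<epsilon>. finite F \<Longrightarrow> F \<subseteq> carrier \<Gamma> \<Longrightarrow> \<epsilon> > 0 \<Longrightarrow>
    \<exists>(A :: 'a set) \<phi>. almost_action \<Gamma> F \<epsilon> A \<phi> \<and>
      (\<forall>g\<in>F. g \<noteq> \<one>\<^bsub>\<Gamma>\<^esub> \<longrightarrow> fixed_density A (\<phi> g) < q)"
  shows "sofic_with \<Gamma> q"
  unfolding sofic_with_def
proof (intro allI impI, elim conjE)
  fix F and \<epsilon> :: real assume F: "finite F" "F \<subseteq> carrier \<Gamma>" and "\<epsilon> > 0"
  then obtain A :: "'a set" and \<phi> where act: "almost_action \<Gamma> F \<epsilon> A \<phi>"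
    and fd: "\<And>g. g \<in> F \<Longrightarrow> g \<noteq> \<one>\<^bsub>\<Gamma>\<^esub> \<Longrightarrow> fixed_density A (\<phi> g) < q"
    using assms by meson
  obtain f where f: "bij_betw f A {1..card A}"
    using finite_same_card_bij[OF almost_actionD(1)[OF act], of "{1..card A}"] by auto
  show "\<exists>(n::nat) \<phi>. almost_action \<Gamma> F \<epsilon> {1..n} \<phi> \<and>
        (\<forall>g\<in>F. g \<noteq> \<one>\<^bsub>\<Gamma>\<^esub> \<longrightarrow> fixed_density {1..n} (\<phi> g) < q)"
  proof (intro exI conjI ballI impI)
    show "almost_action \<Gamma> F \<epsilon> {1..card A} (\<lambda>g b. f (\<phi> g (inv_into A f b)))"
      by (rule almost_action_transfer(1)[OF act F(2) f])
    fix g assume g: "g \<in> F" "g \<noteq> \<one>\<^bsub>\<Gamma>\<^esub>"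
    then have "g \<in> carrier \<Gamma>" using F(2) by auto
    from almost_action_transfer(2)[OF act F(2) f this] fd[OF g]
    show "fixed_density {1..card A} (\<lambda>b. f (\<phi> g (inv_into A f b))) < q" by simp
  qed
qed

text \<open>The constants correspond by \<open>q = 1 - c\<close>, in both directions.\<close>

lemma sofic_iff:
  "sofic \<Gamma> \<longleftrightarrow> group \<Gamma> \<and> (\<exists>q<1. sofic_with \<Gamma> q)"
proof
  assume sof: "sofic \<Gamma>"
  then have grp: "group \<Gamma>" by (simp add: sofic_def)
  from sof obtain c where c: "c > 0" and approx:
    "\<And>F \<epsilon>. finite F \<and> F \<subseteq> carrier \<Gamma> \<and> \<epsilon> > 0 \<Longrightarrow>
      (\<exists>(n::nat) \<phi>. n > 0 \<and>
        \<phi> \<in> carrier \<Gamma> \<rightarrow> carrier (BijGroup {1..n}) \<and>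
        unital \<Gamma> (BijGroup {1..n}) \<phi> \<and>
        multiplicative_approx \<Gamma> (BijGroup {1..n}) (hamming {1..n}) F \<epsilon> \<phi> \<and>
        separating \<Gamma> (BijGroup {1..n}) (hamming {1..n}) F c \<phi>)"
    unfolding sofic_def by blast
  have "sofic_with \<Gamma> (1 - c)"
  proof (rule sofic_withI)
    fix F and \<epsilon> :: real assume F: "finite F" "F \<subseteq> carrier \<Gamma>" "\<epsilon> > 0"
    then obtain n :: nat and \<phi> where n: "n > 0" and
      \<phi>: "\<phi> \<in> carrier \<Gamma> \<rightarrow> carrier (BijGroup {1..n})"
        "unital \<Gamma> (BijGroup {1..n}) \<phi>"
        "multiplicative_approx \<Gamma> (BijGroup {1..n}) (hamming {1..n}) F \<epsilon> \<phi>" and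
      sep: "separating \<Gamma> (BijGroup {1..n}) (hamming {1..n}) F c \<phi>"
      using approx by blast
    have ne: "{1..n} \<noteq> {}" using n by auto
    have "almost_action \<Gamma> F \<epsilon> {1..n} \<phi>"
      by (rule almost_action_of_BijGroup[OF _ ne F(2) \<phi>]) auto
    moreover have "fixed_density {1..n} (\<phi> g) < 1 - c" if "g \<in> F" "g \<noteq> \<one>\<^bsub>\<Gamma>\<^esub>" for g
    proof -
      \<comment> \<open>The unit of \<open>BijGroup\<close> is the identity restricted to
        \<open>{1..n}\<close>, so agreeing with it at a point of \<open>{1..n}\<close> means fixing
        that point.\<close>
      have "hamming {1..n} (\<phi> g) \<one>\<^bsub>BijGroup {1..n}\<^esub> =
          1 - density {1..n} (\<lambda>a. \<phi> g a = (\<lambda>x\<in>{1..n}. x) a)"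
        by (simp add: hamming_def density_def BijGroup_def)
      moreover have "c < hamming {1..n} (\<phi> g) \<one>\<^bsub>BijGroup {1..n}\<^esub>"
        using sep that by (simp add: separating_def)
      moreover have "density {1..n} (\<lambda>a. \<phi> g a = (\<lambda>x\<in>{1..n}. x) a) = fixed_density {1..n} (\<phi> g)"
        unfolding fixed_density_def by (rule density_cong) auto
      ultimately show ?thesis by linarith
    qed
    ultimately show "\<exists>(A :: nat set) \<phi>. almost_action \<Gamma> F \<epsilon> A \<phi> \<and>
      (\<forall>g\<in>F. g \<noteq> \<one>\<^bsub>\<Gamma>\<^esub> \<longrightarrow> fixed_density A (\<phi> g) < 1 - c)" by blast
  qed
  then show "group \<Gamma> \<and> (\<exists>q<1. sofic_with \<Gamma> q)"
    using grp c by (intro conjI exI[of _ "1 - c"]) auto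
next
  assume "group \<Gamma> \<and> (\<exists>q<1. sofic_with \<Gamma> q)"
  then obtain q where grp: "group \<Gamma>" and q: "q < 1" and sof: "sofic_with \<Gamma> q" by auto
  show "sofic \<Gamma>"
    unfolding sofic_def
  proof (intro conjI grp exI[of _ "1 - q"] allI impI, goal_cases)
    case (2 F \<epsilon>)
    then obtain n :: nat and \<phi> where act: "almost_action \<Gamma> F \<epsilon> {1..n} \<phi>"
      and fd: "\<And>g. g \<in> F \<Longrightarrow> g \<noteq> \<one>\<^bsub>\<Gamma>\<^esub> \<Longrightarrow> fixed_density {1..n} (\<phi> g) < q"
      using sof unfolding sofic_with_def by meson
    have n: "n > 0" using almost_actionD(2)[OF act] by auto
    have F: "F \<subseteq> carrier \<Gamma>" using 2 by auto
    let ?\<psi> = "\<lambda>g. restrict (\<phi> g) {1..n}"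
    have "separating \<Gamma> (BijGroup {1..n}) (hamming {1..n}) F (1 - q) ?\<psi>"
      unfolding separating_def
    proof (intro ballI impI)
      fix g assume g: "g \<in> F" "g \<noteq> \<one>\<^bsub>\<Gamma>\<^esub>"
      have "hamming {1..n} (?\<psi> g) \<one>\<^bsub>BijGroup {1..n}\<^esub> =
          1 - density {1..n} (\<lambda>a. ?\<psi> g a = (\<lambda>x\<in>{1..n}. x) a)"
        by (simp add: hamming_def density_def BijGroup_def)
      also have "density {1..n} (\<lambda>a. ?\<psi> g a = (\<lambda>x\<in>{1..n}. x) a) = fixed_density {1..n} (\<phi> g)"
        unfolding fixed_density_def by (rule density_cong) auto
      finally show "1 - q < hamming {1..n} (?\<psi> g) \<one>\<^bsub>BijGroup {1..n}\<^esub>"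
        using fd[OF g] by linarith
    qed
    then show ?case
      using n almost_action_imp_BijGroup[OF act F] by blast
  qed (use q in auto)
qed

lemma sofic_with_mono: "sofic_with \<Gamma> q \<Longrightarrow> q \<le> r \<Longrightarrow> sofic_with \<Gamma> r"
  unfolding sofic_with_def by (meson less_le_trans)

text \<open>Under the diagonal action on pairs the density of fixed points is squared. The error
  doubles, which is why the given approximation is taken with \<open>\<epsilon> / 2\<close>.\<close>

lemma sofic_with_square:
  assumes sof: "sofic_with \<Gamma> q"
  shows "sofic_with \<Gamma> (q\<^sup>2)"
proof (rule sofic_withI)
  fix F and \<epsilon> :: real assume F: "finite F" "F \<subseteq> carrier \<Gamma>" and \<epsilon>: "\<epsilon> > 0"
  then have "\<epsilon> / 2 > 0" by simp
  then obtain n :: nat and \<phi> where act: "almost_action \<Gamma> F (\<epsilon> / 2) {1..n} \<phi>"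
    and fd: "\<And>g. g \<in> F \<Longrightarrow> g \<noteq> \<one>\<^bsub>\<Gamma>\<^esub> \<Longrightarrow> fixed_density {1..n} (\<phi> g) < q"
    using sof F unfolding sofic_with_def by meson
  let ?\<psi> = "\<lambda>g. map_prod (\<phi> g) (\<phi> g)"
  have "almost_action \<Gamma> F \<epsilon> ({1..n} \<times> {1..n}) ?\<psi>"
    using almost_action_times[OF act act] by simp
  moreover have "fixed_density ({1..n} \<times> {1..n}) (?\<psi> g) < q\<^sup>2"
    if "g \<in> F" "g \<noteq> \<one>\<^bsub>\<Gamma>\<^esub>" for g
    unfolding fixed_density_times power2_eq_square
    using fd[OF that] by (intro mult_strict_mono' fixed_density_nonneg)
  ultimately show "\<exists>(A :: (nat \<times> nat) set) \<psi>. almost_action \<Gamma> F \<epsilon> A \<psi> \<and>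
      (\<forall>g\<in>F. g \<noteq> \<one>\<^bsub>\<Gamma>\<^esub> \<longrightarrow> fixed_density A (\<psi> g) < q\<^sup>2)" by blast
qed

text \<open>Repeated squaring turns any bound below 1 into an arbitrarily small one.\<close>

lemma sofic_with_any:
  assumes sof: "sofic_with \<Gamma> q" and q: "q < 1" and r: "0 < r"
  shows "sofic_with \<Gamma> r"
proof -
  \<comment> \<open>Nothing makes \<open>q\<close> nonnegative; after this truncation the base lies
    in [0, 1) and its powers tend to 0.\<close>
  define p where "p = max q 0"
  have p: "0 \<le> p" "p < 1" using q by (auto simp: p_def)
  have pow: "sofic_with \<Gamma> (p ^ (2 ^ k))" for k :: nat
  proof (induction k)
    case 0
    then show ?case using sofic_with_mono[OF sof] by (simp add: p_def)
  next
    case (Suc k)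
    then have "sofic_with \<Gamma> ((p ^ 2 ^ k)\<^sup>2)" by (rule sofic_with_square)
    then show ?case by (simp add: power_mult[symmetric] mult.commute)
  qed
  obtain k where "p ^ k < r" using real_arch_pow_inv[OF r p(2)] by auto
  \<comment> \<open>The exponents satisfy \<open>k \<le> 2 ^ k\<close> and the base is at most
    1.\<close>
  moreover have "p ^ (2 ^ k) \<le> p ^ k"
    using p by (intro power_decreasing) (auto intro: less_imp_le)
  ultimately show ?thesis
    using sofic_with_mono[OF pow[of k]] by simp
qed

text \<open>The bound \<open>r\<close> is prescribed in advance, independently of the group. One
  bound therefore serves all the groups \<Lambda> that a sofic action may produce.\<close>

lemma sofic_obtain:
  assumes "sofic \<Gamma>" "finite F" "F \<subseteq> carrier \<Gamma>" "\<epsilon> > 0" "r > 0"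
  obtains B :: "nat set" and \<theta> where "almost_action \<Gamma> F \<epsilon> B \<theta>"
    "\<And>g. g \<in> F \<Longrightarrow> g \<noteq> \<one>\<^bsub>\<Gamma>\<^esub> \<Longrightarrow> fixed_density B (\<theta> g) < r"
proof -
  obtain q where "sofic_with \<Gamma> q" "q < 1" using assms(1) by (auto simp: sofic_iff)
  then have "sofic_with \<Gamma> r" using \<open>r > 0\<close> by (rule sofic_with_any)
  then have "\<exists>(n::nat) \<phi>. almost_action \<Gamma> F \<epsilon> {1..n} \<phi> \<and>
      (\<forall>g\<in>F. g \<noteq> \<one>\<^bsub>\<Gamma>\<^esub> \<longrightarrow> fixed_density {1..n} (\<phi> g) < r)"
    using assms(2-4) by (simp add: sofic_with_def)
  then show ?thesis using that by blast
qed

section \<open>Semidirect products\<close>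

text \<open>For the last claim, \<open>AutoGroup\<close> is a subgroup of \<open>BijGroup\<close>,
  so inverses agree, and in \<open>BijGroup\<close> the inverse is the restricted inverse
  map.\<close>

lemma AutoGroup_facts:
  assumes \<Delta>: "group \<Delta>" and f: "f \<in> carrier (AutoGroup \<Delta>)"
  shows "f \<in> hom \<Delta> \<Delta>" "bij_betw f (carrier \<Delta>) (carrier \<Delta>)"
    and "x \<in> carrier \<Delta> \<Longrightarrow> (inv\<^bsub>AutoGroup \<Delta>\<^esub> f) (f x) = x"
proof -
  show "f \<in> hom \<Delta> \<Delta>" and bij: "bij_betw f (carrier \<Delta>) (carrier \<Delta>)"
    using f by (auto simp: AutoGroup_def auto_def Bij_def)
  have f_auto: "f \<in> auto \<Delta>" using f by (simp add: AutoGroup_def)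
  assume x: "x \<in> carrier \<Delta>"
  have "inv\<^bsub>AutoGroup \<Delta>\<^esub> f = inv\<^bsub>BijGroup (carrier \<Delta>)\<^esub> f"
    unfolding AutoGroup_def
    using group.m_inv_consistent[OF group_BijGroup group.subgroup_auto[OF \<Delta>] f_auto] .
  also have "\<dots> = (\<lambda>x \<in> carrier \<Delta>. inv_into (carrier \<Delta>) f x)"
    using f_auto by (intro inv_BijGroup) (auto simp: auto_def)
  finally show "(inv\<^bsub>AutoGroup \<Delta>\<^esub> f) (f x) = x"
    using bij x by (auto simp: bij_betw_def)
qed

section \<open>The semidirect product as a group\<close>

lemma semidirect_action:
  assumes "group \<Gamma>" and \<Delta>: "group \<Delta>" and \<beta>: "\<beta> \<in> hom \<Gamma> (AutoGroup \<Delta>)"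
  shows "g \<in> carrier \<Gamma> \<Longrightarrow> \<beta> g \<in> carrier (AutoGroup \<Delta>)"
    and "g \<in> carrier \<Gamma> \<Longrightarrow> x \<in> carrier \<Delta> \<Longrightarrow> \<beta> g x \<in> carrier \<Delta>"
    and "g \<in> carrier \<Gamma> \<Longrightarrow> x \<in> carrier \<Delta> \<Longrightarrow> y \<in> carrier \<Delta> \<Longrightarrow>
      \<beta> g (x \<otimes>\<^bsub>\<Delta>\<^esub> y) = \<beta> g x \<otimes>\<^bsub>\<Delta>\<^esub> \<beta> g y"
    and "g \<in> carrier \<Gamma> \<Longrightarrow> h \<in> carrier \<Gamma> \<Longrightarrow> x \<in> carrier \<Delta> \<Longrightarrow>
      \<beta> (g \<otimes>\<^bsub>\<Gamma>\<^esub> h) x = \<beta> g (\<beta> h x)"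
    and "x \<in> carrier \<Delta> \<Longrightarrow> \<beta> \<one>\<^bsub>\<Gamma>\<^esub> x = x"
proof -
  show aut: "\<beta> g \<in> carrier (AutoGroup \<Delta>)" if "g \<in> carrier \<Gamma>" for g
    using \<beta> that by (auto simp: hom_def)
  note hom = AutoGroup_facts(1)[OF \<Delta> aut]
  show "g \<in> carrier \<Gamma> \<Longrightarrow> x \<in> carrier \<Delta> \<Longrightarrow> \<beta> g x \<in> carrier \<Delta>"
    using hom[of g] by (auto simp: hom_def)
  show "g \<in> carrier \<Gamma> \<Longrightarrow> x \<in> carrier \<Delta> \<Longrightarrow> y \<in> carrier \<Delta> \<Longrightarrow>
      \<beta> g (x \<otimes>\<^bsub>\<Delta>\<^esub> y) = \<beta> g x \<otimes>\<^bsub>\<Delta>\<^esub> \<beta> g y"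
    using hom[of g] by (auto simp: hom_def)
  show "\<beta> (g \<otimes>\<^bsub>\<Gamma>\<^esub> h) x = \<beta> g (\<beta> h x)"
    if "g \<in> carrier \<Gamma>" "h \<in> carrier \<Gamma>" "x \<in> carrier \<Delta>"
  proof -
    have "\<beta> (g \<otimes>\<^bsub>\<Gamma>\<^esub> h) = compose (carrier \<Delta>) (\<beta> g) (\<beta> h)"
      using \<beta> aut[of g] aut[of h] that
      by (auto simp: hom_def AutoGroup_def BijGroup_def auto_def)
    then show ?thesis using that by (simp add: compose_def)
  qed
  have "\<beta> \<one>\<^bsub>\<Gamma>\<^esub> = \<one>\<^bsub>AutoGroup \<Delta>\<^esub>"
    using assms hom_one group.AutoGroup by blast
  then show "x \<in> carrier \<Delta> \<Longrightarrow> \<beta> \<one>\<^bsub>\<Gamma>\<^esub> x = x"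
    by (simp add: AutoGroup_def BijGroup_def)
qed

lemma group_semidirect_product:
  assumes \<Gamma>: "group \<Gamma>" and \<Delta>: "group \<Delta>" and \<beta>: "\<beta> \<in> hom \<Gamma> (AutoGroup \<Delta>)"
  shows "group (semidirect_product \<Delta> \<beta> \<Gamma>)"
proof -
  interpret \<Gamma>: group \<Gamma> by (fact \<Gamma>)
  interpret \<Delta>: group \<Delta> by (fact \<Delta>)
  note act = semidirect_action[OF \<Gamma> \<Delta> \<beta>]
  show ?thesis
  proof (rule groupI, goal_cases)
    case (5 p)
    then obtain x g where p: "p = (x, g)" "x \<in> carrier \<Delta>" "g \<in> carrier \<Gamma>"
      by (auto simp: semidirect_product_def)
    \<comment> \<open>A left inverse of \<open>(x, g)\<close> is \<open>(y, g')\<close>, where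
      \<open>y\<close> is the inverse of \<open>\<beta> g' x\<close> in \<Delta>.\<close>
    define g' where "g' = inv\<^bsub>\<Gamma>\<^esub> g"
    have g': "g' \<in> carrier \<Gamma>" "g' \<otimes>\<^bsub>\<Gamma>\<^esub> g = \<one>\<^bsub>\<Gamma>\<^esub>" using p by (auto simp: g'_def)
    then show ?case
      using p act(2)[OF g'(1) p(2)]
      by (intro bexI[of _ "(inv\<^bsub>\<Delta>\<^esub> (\<beta> g' x), g')"]) (auto simp: semidirect_product_def)
  qed (auto simp: semidirect_product_def act \<Gamma>.m_assoc \<Delta>.m_assoc)
qed

section \<open>Skew products twisted by partial homomorphisms\<close>

lemma partial_hom_one:
  assumes "partial_hom \<Delta> E \<Lambda> \<pi>" "group \<Delta>" "group \<Lambda>" "\<one>\<^bsub>\<Delta>\<^esub> \<in> E"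
  shows "\<pi> \<one>\<^bsub>\<Delta>\<^esub> = \<one>\<^bsub>\<Lambda>\<^esub>"
proof -
  interpret \<Delta>: group \<Delta> by (fact assms)
  interpret \<Lambda>: group \<Lambda> by (fact assms)
  \<comment> \<open>The product of the unit with itself stays in \<open>E\<close>, so its image is
    an idempotent of a group, hence the unit.\<close>
  have "\<pi> \<one>\<^bsub>\<Delta>\<^esub> \<in> carrier \<Lambda>" "\<pi> \<one>\<^bsub>\<Delta>\<^esub> = \<pi> \<one>\<^bsub>\<Delta>\<^esub> \<otimes>\<^bsub>\<Lambda>\<^esub> \<pi> \<one>\<^bsub>\<Delta>\<^esub>"
    using assms(1,4) unfolding partial_hom_def by (auto, metis \<Delta>.l_one \<Delta>.one_closed)
  then show ?thesis by (metis \<Lambda>.r_cancel_one')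
qed

text \<open>The fibre over \<open>a\<close> is carried bijectively onto the fibre over
  \<open>\<sigma> a\<close>. The twist is indexed by the target point, as in the action of the
  semidirect product.\<close>

lemma bij_betw_skew_product:
  assumes \<sigma>: "bij_betw \<sigma> A A" and \<tau>: "\<And>a. a \<in> A \<Longrightarrow> bij_betw (\<tau> a) B B"
  shows "bij_betw (\<lambda>(a, b). (\<sigma> a, \<tau> (\<sigma> a) b)) (A \<times> B) (A \<times> B)"
proof (rule bij_betw_imageI)
  have in_A: "\<sigma> a \<in> A" if "a \<in> A" for a using \<sigma> that by (auto simp: bij_betw_def)
  show "inj_on (\<lambda>(a, b). (\<sigma> a, \<tau> (\<sigma> a) b)) (A \<times> B)"
  proof (rule inj_onI, clarsimp)
    fix a b a' b' assume *: "a \<in> A" "b \<in> B" "a' \<in> A" "b' \<in> B" "\<sigma> a = \<sigma> a'" "\<tau> (\<sigma> a') b = \<tau> (\<sigma> a') b'"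
    then show "a = a' \<and> b = b'"
      using \<sigma> \<tau>[OF in_A[OF *(3)]] by (auto simp: bij_betw_def inj_on_def)
  qed
  show "(\<lambda>(a, b). (\<sigma> a, \<tau> (\<sigma> a) b)) ` (A \<times> B) = A \<times> B"
  proof (intro equalityI subsetI)
    fix p assume "p \<in> A \<times> B"
    then obtain c d where p: "p = (c, d)" "c \<in> A" "d \<in> B" by auto
    obtain a where a: "a \<in> A" "c = \<sigma> a" using \<sigma> p by (auto simp: bij_betw_def)
    obtain b where "b \<in> B" "d = \<tau> c b" using \<tau>[OF p(2)] p(3) by (auto simp: bij_betw_def)
    then show "p \<in> (\<lambda>(a, b). (\<sigma> a, \<tau> (\<sigma> a) b)) ` (A \<times> B)"
      using a p by (intro image_eqI[of _ _ "(a, b)"]) auto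
  next
    fix p assume "p \<in> (\<lambda>(a, b). (\<sigma> a, \<tau> (\<sigma> a) b)) ` (A \<times> B)"
    then obtain a b where ab: "p = (\<sigma> a, \<tau> (\<sigma> a) b)" "a \<in> A" "b \<in> B" by auto
    then show "p \<in> A \<times> B"
      using in_A \<tau>[OF in_A[OF ab(2)]] by (auto simp: bij_betw_def)
  qed
qed

text \<open>The error \<open>4 * \<delta>\<close> has four sources: failure of multiplicativity of
  \<open>\<phi>\<close>, two points of \<open>A\<close> that may leave \<open>S\<close>, and failure
  of multiplicativity of \<open>\<theta>\<close> in a fibre. Only elements with trivial second
  component are separated here; the others may well have \<open>\<phi> g\<close> close to the
  identity.\<close>

lemma semidirect_almost_action:
  fixes \<Lambda> :: "('l, 'k) monoid_scheme" and A :: "'a set" and B :: "'b set"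
  assumes \<Gamma>: "group \<Gamma>" and \<Delta>: "group \<Delta>" and \<Lambda>: "group \<Lambda>" and \<beta>: "\<beta> \<in> hom \<Gamma> (AutoGroup \<Delta>)"
    and F: "F \<subseteq> carrier \<Delta> \<times> carrier \<Gamma>"
    and E: "fst ` F \<subseteq> E" "\<one>\<^bsub>\<Delta>\<^esub> \<in> E"
      "\<And>x g y h. (x, g) \<in> F \<Longrightarrow> (y, h) \<in> F \<Longrightarrow> \<beta> g y \<in> E"
    and \<phi>: "almost_action \<Gamma> (snd ` F) \<delta> A \<phi>"
    and S: "S \<subseteq> A" "density A (\<lambda>a. a \<notin> S) < \<delta>"
    and \<pi>: "\<And>s. s \<in> S \<Longrightarrow> partial_hom \<Delta> E \<Lambda> (\<pi> s)" "\<And>s. s \<in> S \<Longrightarrow> inj_on (\<pi> s) E"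
    and equiv: "\<And>g h s. g \<in> snd ` F \<Longrightarrow> h \<in> E \<Longrightarrow> s \<in> S \<Longrightarrow> \<phi> g s \<in> S \<Longrightarrow>
      (inv\<^bsub>AutoGroup \<Delta>\<^esub> (\<beta> g)) h \<in> E \<Longrightarrow> \<pi> (\<phi> g s) h = \<pi> s ((inv\<^bsub>AutoGroup \<Delta>\<^esub> (\<beta> g)) h)"
    and \<theta>: "almost_action \<Lambda> (\<Union>s\<in>S. \<pi> s ` E) \<delta> B \<theta>"
      "\<And>l. l \<in> (\<Union>s\<in>S. \<pi> s ` E) \<Longrightarrow> l \<noteq> \<one>\<^bsub>\<Lambda>\<^esub> \<Longrightarrow> fixed_density B (\<theta> l) < r"
    and r: "0 \<le> r"
  shows "\<exists>\<Phi>. almost_action (semidirect_product \<Delta> \<beta> \<Gamma>) F (4 * \<delta>) (A \<times> B) \<Phi> \<and>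
    (\<forall>x. (x, \<one>\<^bsub>\<Gamma>\<^esub>) \<in> F \<and> x \<noteq> \<one>\<^bsub>\<Delta>\<^esub> \<longrightarrow>
      fixed_density (A \<times> B) (\<Phi> (x, \<one>\<^bsub>\<Gamma>\<^esub>)) < r + \<delta>)"
proof -
  interpret \<Gamma>: group \<Gamma> by (fact \<Gamma>)
  interpret \<Delta>: group \<Delta> by (fact \<Delta>)
  let ?G = "semidirect_product \<Delta> \<beta> \<Gamma>"
  note act = semidirect_action[OF \<Gamma> \<Delta> \<beta>]
  note A = almost_actionD[OF \<phi>] and B = almost_actionD[OF \<theta>(1)]
  \<comment> \<open>The default \<open>id\<close> outside \<open>S\<close> and \<open>E\<close>
    makes every element of the semidirect product act by a permutation, also where no partial
    homomorphism is available.\<close>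
  define \<eta> where "\<eta> x a = (if a \<in> S \<and> x \<in> E then \<theta> (\<pi> a x) else id)" for x a
  define \<Phi> where "\<Phi> = (\<lambda>(x, g) (a, b). (\<phi> g a, \<eta> x (\<phi> g a) b))"
  have \<pi>_one: "\<pi> s \<one>\<^bsub>\<Delta>\<^esub> = \<one>\<^bsub>\<Lambda>\<^esub>" if "s \<in> S" for s
    using partial_hom_one[OF \<pi>(1)[OF that] \<Delta> \<Lambda> E(2)] .
  have \<pi>_carrier: "\<pi> s x \<in> carrier \<Lambda>" if "s \<in> S" "x \<in> E" for s x
    using \<pi>(1)[OF that(1)] that(2) by (auto simp: partial_hom_def)
  have \<eta>_bij: "bij_betw (\<eta> x a) B B" for x a
    using B(3)[OF \<pi>_carrier] by (auto simp: \<eta>_def)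
  have in_A: "\<phi> g a \<in> A" if "g \<in> carrier \<Gamma>" "a \<in> A" for g a
    using A(3) that by (auto simp: bij_betw_def)
  have \<delta>: "0 \<le> \<delta>" using S(2) density_nonneg[of A "\<lambda>a. a \<notin> S"] by linarith
  have "almost_action ?G F (4 * \<delta>) (A \<times> B) \<Phi>"
    unfolding almost_action_def
  proof (intro conjI ballI impI)
    show "finite (A \<times> B)" "A \<times> B \<noteq> {}" using A B by auto
    show "bij_betw (\<Phi> p) (A \<times> B) (A \<times> B)" if p_in: "p \<in> carrier ?G" for p
    proof -
      obtain x g where p: "p = (x, g)" "g \<in> carrier \<Gamma>"
        using p_in by (auto simp: semidirect_product_def)
      show ?thesis
        using bij_betw_skew_product[OF A(3)[OF p(2)] \<eta>_bij] by (simp add: p \<Phi>_def)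
    qed
    show "\<Phi> \<one>\<^bsub>?G\<^esub> p = p" if "p \<in> A \<times> B" for p
      using that A(4) B(4) \<pi>_one by (auto simp: \<Phi>_def \<eta>_def semidirect_product_def)
    fix p p' assume pp': "p \<in> F" "p' \<in> F" "p \<otimes>\<^bsub>?G\<^esub> p' \<in> F"
    obtain x g y h where p: "p = (x, g)" and p': "p' = (y, h)" by (metis surj_pair)
    define gh where "gh = g \<otimes>\<^bsub>\<Gamma>\<^esub> h"
    define z where "z = x \<otimes>\<^bsub>\<Delta>\<^esub> \<beta> g y"
    have mult: "p \<otimes>\<^bsub>?G\<^esub> p' = (z, gh)"
      by (simp add: p p' semidirect_product_def z_def gh_def)
    have car: "x \<in> carrier \<Delta>" "y \<in> carrier \<Delta>" "g \<in> carrier \<Gamma>" "h \<in> carrier \<Gamma>"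
      using F pp' p p' by auto
    have in_F: "g \<in> snd ` F" "h \<in> snd ` F" "gh \<in> snd ` F"
      using pp' p p' mult by force+
    have in_E: "x \<in> E" "y \<in> E" "z \<in> E" "\<beta> g y \<in> E"
      using pp' p p' mult E(1) E(3) by force+
    have \<beta>_inv: "(inv\<^bsub>AutoGroup \<Delta>\<^esub> (\<beta> g)) (\<beta> g y) = y"
      using AutoGroup_facts(3)[OF \<Delta> act(1)] car by blast
    let ?N = "\<lambda>a. \<phi> gh a \<noteq> \<phi> g (\<phi> h a)"
    \<comment> \<open>Bad base points. Away from them \<open>s = \<phi> h a\<close> and
      \<open>t = \<phi> gh a\<close> lie in \<open>S\<close> and \<open>t = \<phi> g s\<close>, so
      equivariance applies from \<open>s\<close> to \<open>t\<close>.\<close>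
    let ?P = "\<lambda>a. (?N a \<or> \<phi> h a \<notin> S) \<or> \<phi> gh a \<notin> S"
    let ?R = "\<lambda>a b. \<Phi> (z, gh) (a, b) \<noteq> \<Phi> (x, g) (\<Phi> (y, h) (a, b))"
    \<comment> \<open>\<open>\<phi> k\<close> permutes \<open>A\<close>, so the points it sends
      outside \<open>S\<close> are as frequent as the points outside \<open>S\<close>.\<close>
    have exit: "density A (\<lambda>a. \<phi> k a \<notin> S) < \<delta>" if "k \<in> carrier \<Gamma>" for k
      using density_bij[OF A(3)[OF that], of "\<lambda>a. a \<notin> S"] S(2) by simp
    have "density A ?P \<le> density A ?N + density A (\<lambda>a. \<phi> h a \<notin> S) + density A (\<lambda>a. \<phi> gh a \<notin> S)"
      using density_disj[of A "\<lambda>a. ?N a \<or> \<phi> h a \<notin> S" "\<lambda>a. \<phi> gh a \<notin> S"]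
        density_disj[of A ?N "\<lambda>a. \<phi> h a \<notin> S"] by linarith
    also have "\<dots> < 3 * \<delta>"
      using A(5)[OF in_F(1,2)] in_F(3) exit[OF car(4)] exit[of gh] car(3,4) by (simp add: gh_def)
    finally have P: "density A ?P < 3 * \<delta>" .
    have "density (A \<times> B) (\<lambda>(a, b). ?R a b) \<le> density A ?P + \<delta>"
    proof (intro density_fibrewise A B \<delta>)
      fix a assume a: "a \<in> A" "\<not> ?P a"
      define s where "s = \<phi> h a"
      define t where "t = \<phi> gh a"
      have st: "s \<in> S" "t \<in> S" "t = \<phi> g s" using a by (auto simp: s_def t_def)
      \<comment> \<open>Equivariance is applied to the element \<open>\<beta> g y\<close>, which the
        inverse automorphism takes back to \<open>y\<close>.\<close>
      have \<pi>_y: "\<pi> t (\<beta> g y) = \<pi> s y"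
        using equiv[OF in_F(1) in_E(4) st(1)] st in_E(2) \<beta>_inv by simp
      then have \<pi>_z: "\<pi> t z = \<pi> t x \<otimes>\<^bsub>\<Lambda>\<^esub> \<pi> s y"
        using \<pi>(1)[OF st(2)] in_E unfolding partial_hom_def z_def by metis
      have "\<pi> t x \<in> (\<Union>s\<in>S. \<pi> s ` E)" "\<pi> s y \<in> (\<Union>s\<in>S. \<pi> s ` E)"
        "\<pi> t x \<otimes>\<^bsub>\<Lambda>\<^esub> \<pi> s y \<in> (\<Union>s\<in>S. \<pi> s ` E)"
        using st in_E \<pi>_z[symmetric] by auto
      then have "density B (\<lambda>b. \<theta> (\<pi> t z) b \<noteq> \<theta> (\<pi> t x) (\<theta> (\<pi> s y) b)) < \<delta>"
        unfolding \<pi>_z by (rule B(5))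
      moreover have "density B (?R a) = density B (\<lambda>b. \<theta> (\<pi> t z) b \<noteq> \<theta> (\<pi> t x) (\<theta> (\<pi> s y) b))"
        using st in_E by (intro density_cong) (simp add: \<Phi>_def \<eta>_def flip: s_def t_def)
      ultimately show "density B (?R a) \<le> \<delta>" by simp
    qed
    also have "\<dots> < 4 * \<delta>" using P by simp
    finally show "density (A \<times> B) (\<lambda>q. \<Phi> (p \<otimes>\<^bsub>?G\<^esub> p') q \<noteq> \<Phi> p (\<Phi> p' q)) < 4 * \<delta>"
      unfolding mult by (simp add: p p' case_prod_unfold)
  qed
  moreover have "fixed_density (A \<times> B) (\<Phi> (x, \<one>\<^bsub>\<Gamma>\<^esub>)) < r + \<delta>"
    if x: "(x, \<one>\<^bsub>\<Gamma>\<^esub>) \<in> F" "x \<noteq> \<one>\<^bsub>\<Delta>\<^esub>" for x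
  proof -
    have xE: "x \<in> E" using E(1) x(1) by force
    \<comment> \<open>Since \<open>\<phi>\<close> of the unit fixes \<open>A\<close> pointwise, each
      fibre is preserved; over \<open>a\<close> in \<open>S\<close> the action is
      \<open>\<theta> (\<pi> a x)\<close>, and injectivity of \<open>\<pi> a\<close> keeps
      \<open>\<pi> a x\<close> away from the unit.\<close>
    have "density (A \<times> B) (\<lambda>(a, b). \<Phi> (x, \<one>\<^bsub>\<Gamma>\<^esub>) (a, b) = (a, b)) \<le> density A (\<lambda>a. a \<notin> S) + r"
    proof (intro density_fibrewise A B r)
      fix a assume a: "a \<in> A" "\<not> a \<notin> S"
      have "\<pi> a x \<noteq> \<one>\<^bsub>\<Lambda>\<^esub>"
        using inj_onD[OF \<pi>(2) _ xE E(2)] \<pi>_one a x(2) by metis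
      then have "fixed_density B (\<theta> (\<pi> a x)) < r"
        using \<theta>(2) a xE by blast
      moreover have "density B (\<lambda>b. \<Phi> (x, \<one>\<^bsub>\<Gamma>\<^esub>) (a, b) = (a, b)) = fixed_density B (\<theta> (\<pi> a x))"
        using a xE A(4) unfolding fixed_density_def
        by (intro density_cong) (simp add: \<Phi>_def \<eta>_def)
      ultimately show "density B (\<lambda>b. \<Phi> (x, \<one>\<^bsub>\<Gamma>\<^esub>) (a, b) = (a, b)) \<le> r" by simp
    qed
    then show ?thesis
      using S(2) by (simp add: fixed_density_def case_prod_unfold)
  qed
  ultimately show ?thesis by blast
qed

section \<open>Combining the skew product with a sofic approximation of \<Gamma>\<close>

theorem theorem1p1:
  fixes \<Gamma> :: "('g, 'm) monoid_scheme"
    and \<Delta> :: "('d, 'n) monoid_scheme"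
    and \<beta> :: "'g \<Rightarrow> 'd \<Rightarrow> 'd"
  assumes "sofic \<Gamma>" and "sofic \<Delta>"
    and "sofic_action {\<Lambda> :: 'l monoid. sofic \<Lambda>} \<Gamma> \<Delta> \<beta>"
  shows "sofic (semidirect_product \<Delta> \<beta> \<Gamma>)"
proof -
  let ?G = "semidirect_product \<Delta> \<beta> \<Gamma>"
  have \<Gamma>: "group \<Gamma>" and \<Delta>: "group \<Delta>" using assms(1,2) by (auto simp: sofic_def)
  have \<beta>: "\<beta> \<in> hom \<Gamma> (AutoGroup \<Delta>)" using assms(3) by (simp add: sofic_action_def)
  note act = semidirect_action[OF \<Gamma> \<Delta> \<beta>]
  have one: "\<one>\<^bsub>\<Delta>\<^esub> \<in> carrier \<Delta>" using \<Delta> by (simp add: group.is_monoid)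
  have G: "carrier ?G = carrier \<Delta> \<times> carrier \<Gamma>" "\<one>\<^bsub>?G\<^esub> = (\<one>\<^bsub>\<Delta>\<^esub>, \<one>\<^bsub>\<Gamma>\<^esub>)"
    by (auto simp: semidirect_product_def)
  have "sofic_with ?G (3 / 4)"
  proof (rule sofic_withI)
    fix F and \<epsilon> :: real assume F: "finite F" "F \<subseteq> carrier ?G" and \<epsilon>: "\<epsilon> > 0"
    \<comment> \<open>The skew product costs \<open>4 * \<delta>\<close> and the factor for \<Gamma>
      another \<open>\<delta>\<close>; the cap 1/4 makes the fixed-point bound
      \<open>1 / 2 + \<delta>\<close> at most 3/4.\<close>
    define \<delta> where "\<delta> = min (\<epsilon> / 5) (1 / 4)"
    have \<delta>: "\<delta> > 0" "5 * \<delta> \<le> \<epsilon>" "\<delta> \<le> 1 / 4" using \<epsilon> by (auto simp: \<delta>_def)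
    define F\<^sub>2 where "F\<^sub>2 = snd ` F"
    \<comment> \<open>The unit is included so that partial homomorphisms preserve it, and all
      \<open>\<beta> g y\<close> so that a product in \<open>F\<close> can be split inside
      \<open>E\<close>.\<close>
    define E where "E = insert \<one>\<^bsub>\<Delta>\<^esub> (fst ` F \<union> (\<lambda>(p, q). \<beta> (snd p) (fst q)) ` (F \<times> F))"
    have F\<^sub>2: "finite F\<^sub>2" "F\<^sub>2 \<subseteq> carrier \<Gamma>" using F G by (auto simp: F\<^sub>2_def)
    have "\<beta> (snd p) (fst q) \<in> carrier \<Delta>" if "p \<in> F" "q \<in> F" for p q
      using that F(2) G(1) by (intro act(2)) auto
    then have E: "finite E" "E \<subseteq> carrier \<Delta>"
      using F G(1) one by (auto simp: E_def)
    obtain \<Lambda> :: "'l monoid" and A :: "nat set" and \<phi> where \<Lambda>: "sofic \<Lambda>" and finA: "finite A"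
      and \<phi>: "\<phi> \<in> carrier \<Gamma> \<rightarrow> carrier (BijGroup A)" "unital \<Gamma> (BijGroup A) \<phi>"
        "multiplicative_approx \<Gamma> (BijGroup A) (hamming A) F\<^sub>2 \<delta> \<phi>"
      and aut: "automorphic_approx \<Delta> \<beta> A F\<^sub>2 E \<delta> \<Lambda> \<phi>"
      using assms(3)[unfolded sofic_action_def, THEN conjunct2, rule_format, of F\<^sub>2 E \<delta>] F\<^sub>2 E \<delta>(1)
      by auto
    obtain S \<pi> where S: "S \<subseteq> A" "real (card S) > (1 - \<delta>) * real (card A)"
      and \<pi>: "\<And>s. s \<in> S \<Longrightarrow> partial_hom \<Delta> E \<Lambda> (\<pi> s)" "\<And>s. s \<in> S \<Longrightarrow> inj_on (\<pi> s) E"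
      and equiv: "\<And>g h s. g \<in> F\<^sub>2 \<Longrightarrow> h \<in> E \<Longrightarrow> s \<in> S \<Longrightarrow> \<phi> g s \<in> S \<Longrightarrow>
        (inv\<^bsub>AutoGroup \<Delta>\<^esub> (\<beta> g)) h \<in> E \<Longrightarrow> \<pi> (\<phi> g s) h = \<pi> s ((inv\<^bsub>AutoGroup \<Delta>\<^esub> (\<beta> g)) h)"
      using aut unfolding automorphic_approx_def by blast
    \<comment> \<open>For empty \<open>A\<close> the strict inequality on \<open>card S\<close>
      would read 0 > 0.\<close>
    have ne: "A \<noteq> {}" using S by auto
    have "density A (\<lambda>a. a \<in> S) > 1 - \<delta>"
    proof -
      have "{a \<in> A. a \<in> S} = S" using S by auto
      then show ?thesis
        using S(2) finA ne by (simp add: density_def less_divide_eq card_gt_0_iff)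
    qed
    then have dens: "density A (\<lambda>a. a \<notin> S) < \<delta>"
      using density_compl[OF finA ne, of "\<lambda>a. a \<in> S"] by simp
    \<comment> \<open>All values of all the partial homomorphisms, a finite set because
      \<open>S\<close> and \<open>E\<close> are finite; one sofic approximation of \<Lambda> thus
      serves every \<open>s\<close> in \<open>S\<close>.\<close>
    define L where "L = (\<Union>s\<in>S. \<pi> s ` E)"
    have "finite S" using S(1) finA by (rule finite_subset)
    then have L: "finite L" "L \<subseteq> carrier \<Lambda>"
      using \<pi>(1) E(1) by (auto simp: L_def partial_hom_def)
    \<comment> \<open>\<Lambda> depends on \<open>F\<close> and \<open>\<epsilon>\<close>, so its
      own separation constant is useless here; amplification supplies the uniform bound 1/2.\<close>
    obtain B :: "nat set" and \<theta> where \<theta>: "almost_action \<Lambda> L \<delta> B \<theta>"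
      "\<And>l. l \<in> L \<Longrightarrow> l \<noteq> \<one>\<^bsub>\<Lambda>\<^esub> \<Longrightarrow> fixed_density B (\<theta> l) < 1 / 2"
      using sofic_obtain[OF \<Lambda> L \<delta>(1), of "1 / 2"] by auto
    obtain C :: "nat set" and \<psi> where \<psi>: "almost_action \<Gamma> F\<^sub>2 \<delta> C \<psi>"
      "\<And>g. g \<in> F\<^sub>2 \<Longrightarrow> g \<noteq> \<one>\<^bsub>\<Gamma>\<^esub> \<Longrightarrow> fixed_density C (\<psi> g) < 1 / 2"
      using sofic_obtain[OF assms(1) F\<^sub>2 \<delta>(1), of "1 / 2"] by auto
    have \<phi>': "almost_action \<Gamma> F\<^sub>2 \<delta> A \<phi>"
      by (rule almost_action_of_BijGroup[OF finA ne F\<^sub>2(2) \<phi>])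
    have "group \<Lambda>" using \<Lambda> by (simp add: sofic_def)
    have F_E: "fst ` F \<subseteq> E" "\<one>\<^bsub>\<Delta>\<^esub> \<in> E"
      "\<And>x g y h. (x, g) \<in> F \<Longrightarrow> (y, h) \<in> F \<Longrightarrow> \<beta> g y \<in> E"
      by (force simp: E_def)+
    have F': "F \<subseteq> carrier \<Delta> \<times> carrier \<Gamma>" using F(2) G(1) by simp
    have "\<exists>\<Phi>. almost_action ?G F (4 * \<delta>) (A \<times> B) \<Phi> \<and>
        (\<forall>x. (x, \<one>\<^bsub>\<Gamma>\<^esub>) \<in> F \<and> x \<noteq> \<one>\<^bsub>\<Delta>\<^esub> \<longrightarrow>
          fixed_density (A \<times> B) (\<Phi> (x, \<one>\<^bsub>\<Gamma>\<^esub>)) < 1 / 2 + \<delta>)"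
      using semidirect_almost_action[OF \<Gamma> \<Delta> \<open>group \<Lambda>\<close> \<beta> F' F_E \<phi>'[unfolded F\<^sub>2_def] S(1) dens
          \<pi> equiv[unfolded F\<^sub>2_def] \<theta>[unfolded L_def]] by simp
    then obtain \<Phi> where \<Phi>: "almost_action ?G F (4 * \<delta>) (A \<times> B) \<Phi>"
      "\<And>x. (x, \<one>\<^bsub>\<Gamma>\<^esub>) \<in> F \<Longrightarrow> x \<noteq> \<one>\<^bsub>\<Delta>\<^esub> \<Longrightarrow>
          fixed_density (A \<times> B) (\<Phi> (x, \<one>\<^bsub>\<Gamma>\<^esub>)) < 1 / 2 + \<delta>"
      by blast
    have "snd \<in> hom ?G \<Gamma>" by (auto simp: hom_def semidirect_product_def)
    then have \<psi>': "almost_action ?G F \<delta> C (\<lambda>p. \<psi> (snd p))"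
      by (rule almost_action_pullback[OF \<psi>(1)[unfolded F\<^sub>2_def] _ F(2)]) (simp add: G(2))
    let ?\<Psi> = "\<lambda>p. map_prod (\<Phi> p) (\<psi> (snd p))"
    have "almost_action ?G F \<epsilon> ((A \<times> B) \<times> C) ?\<Psi>"
      using almost_action_mono[OF almost_action_times[OF \<Phi>(1) \<psi>']] \<delta>(2) by simp
    moreover have "fixed_density ((A \<times> B) \<times> C) (?\<Psi> p) < 3 / 4" if p: "p \<in> F" "p \<noteq> \<one>\<^bsub>?G\<^esub>" for p
    proof -
      have fin: "finite (A \<times> B)" "finite C"
        using almost_actionD(1)[OF \<Phi>(1)] almost_actionD(1)[OF \<psi>(1)] by auto
      have le1: "fixed_density (A \<times> B) (\<Phi> p) \<le> 1" "fixed_density C (\<psi> (snd p)) \<le> 1"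
        using fin by (simp_all add: fixed_density_le_1)
      obtain x g where xg: "p = (x, g)" by (metis surj_pair)
      show ?thesis
      \<comment> \<open>The fixed density is a product of two numbers in [0, 1], so one small factor
        suffices: the skew product provides it for trivial \<open>g\<close>, the approximation of
        \<Gamma> otherwise.\<close>
      proof (cases "g = \<one>\<^bsub>\<Gamma>\<^esub>")
        case True
        then have "fixed_density (A \<times> B) (\<Phi> p) < 3 / 4"
          using \<Phi>(2)[of x] p xg G \<delta>(3) by fastforce
        moreover have "fixed_density (A \<times> B) (\<Phi> p) * fixed_density C (\<psi> (snd p))
            \<le> fixed_density (A \<times> B) (\<Phi> p)"
          using le1(2) fixed_density_nonneg by (rule mult_left_le)
        ultimately show ?thesis
          unfolding fixed_density_times by linarith
      next
        case False
        then have "fixed_density C (\<psi> (snd p)) < 1 / 2"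
          using \<psi>(2)[of g] p xg by (force simp: F\<^sub>2_def)
        moreover have "fixed_density (A \<times> B) (\<Phi> p) * fixed_density C (\<psi> (snd p))
            \<le> fixed_density C (\<psi> (snd p))"
          using fixed_density_nonneg fixed_density_nonneg le1(1) by (rule mult_left_le_one_le)
        ultimately show ?thesis
          unfolding fixed_density_times by linarith
      qed
    qed
    ultimately show "\<exists>(A :: ((nat \<times> nat) \<times> nat) set) \<phi>. almost_action ?G F \<epsilon> A \<phi> \<and>
      (\<forall>g\<in>F. g \<noteq> \<one>\<^bsub>?G\<^esub> \<longrightarrow> fixed_density A (\<phi> g) < 3 / 4)" by blast
  qed
  then show ?thesis
    unfolding sofic_iff using group_semidirect_product[OF \<Gamma> \<Delta> \<beta>] by (intro conjI exI[of _ "3 / 4"]) auto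
qed

end
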